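(* Let $m\ge2$, $r=\frac1{4m}$, and $\Phi_r(u)=u+\frac{r}{1-u}$, so $\partial_u\Phi_r(u)=1+\frac{r}{(1-u)^2}$. Let $H_k(x)=\sum_{j=k}^{m-1}G_j(x)$ for $0\le k\le m-1$. Then the limits $q_k(m):=\lim_{n\to\infty}[x^n]H_k(x)/[x^n]G(x)$ and $p_k(m):=\lim_{n\to\infty}g_n^{(k)}/g_n$ exist for $0\le k\le m-1$; one has $H_k(r)=\Phi_r(H_{k+1}(r))$ for $0\le k\le m-2$; and $$q_{m-1}(m)=p_{m-1}(m),\qquad q_k(m)=\bigl(\partial_u\Phi_r(H_{k+1}(r))\bigr)\,q_{k+1}(m),\qquad p_k(m)=q_k(m)-q_{k+1}(m)\qquad(0\le k\le m-2).$$
   Context: For an integer $m\ge2$ let $V_m=\{v_0<v_1<\cdots<v_{m-1}\}$ ($v_0=0$, $v_{m-1}=1$) be an $m$-element chain with Gödel implication $v_p\Rightarrow_G v_q=v_{m-1}$ if $p\le q$ and $v_p\Rightarrow_G v_q=v_q$ if $p>q$. For $n\ge1$, consider the $C_{n-1}$ full bracketings of $p_1\Rightarrow_G\cdots\Rightarrow_G p_n$ in $n$ distinct variables (full binary trees with $n$ ordered leaves), $C_k$ being the Catalan numbers. Let $g_n^{(j)}$ be the number of pairs (bracketing, valuation $\{p_1,\dots,p_n\}\to V_m$) for which the bracketed formula evaluates to $v_j$, and $g_n=\sum_{j=0}^{m-1}g_n^{(j)}=m^nC_{n-1}$. Put $G_j(x)=\sum_{n\ge1}g_n^{(j)}x^n$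 and $G(x)=\sum_{n\ge1}g_nx^n$; these power series converge for $|x|\le r=\frac1{4m}$, and $H_k(r)$ denotes the sum at $x=r$. $[x^n]$ denotes coefficient extraction. *)

theory Defs
  imports "HOL-Analysis.Analysis"
begin

datatype formula = Var nat | Imp formula formula

fun leaves :: "formula \<Rightarrow> nat list" where
  "leaves (Var i) = [i]"
| "leaves (Imp a b) = leaves a @ leaves b"

definition bracketings :: "nat \<Rightarrow> formula set" where
  "bracketings n = {t. leaves t = [1..<Suc n]}"

text \<open>
  A chain is given by its increasing enumeration \<open>v 0 = 0\<close>, \dots, \<open>v (m - 1) = 1\<close>; the constants
  \<open>0\<close> and \<open>1\<close> carry no arithmetic meaning, they only name its least and greatest element.
\<close>

definition godel_chain :: "nat \<Rightarrow> (nat \<Rightarrow> 'a::{linorder,zero,one}) \<Rightarrow> bool" where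
  "godel_chain m v \<longleftrightarrow> strict_mono_on {..<m} v \<and> v 0 = 0 \<and> v (m - 1) = 1"

definition godel_imp :: "'a::{linorder,zero,one} \<Rightarrow> 'a \<Rightarrow> 'a" where
  "godel_imp a b = (if a \<le> b then 1 else b)"

fun truth :: "(nat \<Rightarrow> 'a::{linorder,zero,one}) \<Rightarrow> formula \<Rightarrow> 'a" where
  "truth s (Var i) = s i"
| "truth s (Imp a b) = godel_imp (truth s a) (truth s b)"

definition g_val :: "nat \<Rightarrow> (nat \<Rightarrow> 'a::{linorder,zero,one}) \<Rightarrow> nat \<Rightarrow> nat \<Rightarrow> nat" where
  "g_val m v j n =
     card {(t, s). t \<in> bracketings n \<and> s \<in> {1..n} \<rightarrow>\<^sub>E v ` {..<m} \<and> truth s t = v j}"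

definition g_all :: "nat \<Rightarrow> (nat \<Rightarrow> 'a::{linorder,zero,one}) \<Rightarrow> nat \<Rightarrow> nat" where
  "g_all m v n = (\<Sum>j<m. g_val m v j n)"

definition gen_fps :: "(nat \<Rightarrow> nat) \<Rightarrow> real fps" where
  "gen_fps a = Abs_fps (\<lambda>n. if n \<ge> 1 then real (a n) else 0)"

definition G_val :: "nat \<Rightarrow> (nat \<Rightarrow> 'a::{linorder,zero,one}) \<Rightarrow> nat \<Rightarrow> real fps" where
  "G_val m v j = gen_fps (g_val m v j)"

definition G_all :: "nat \<Rightarrow> (nat \<Rightarrow> 'a::{linorder,zero,one}) \<Rightarrow> real fps" where
  "G_all m v = gen_fps (g_all m v)"

definition H_sum :: "nat \<Rightarrow> (nat \<Rightarrow> 'a::{linorder,zero,one}) \<Rightarrow> nat \<Rightarrow> real fps" where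
  "H_sum m v k = (\<Sum>j=k..m - 1. G_val m v j)"

definition Phi :: "real \<Rightarrow> real \<Rightarrow> real" where
  "Phi r u = u + r / (1 - u)"

definition q_ratio :: "nat \<Rightarrow> (nat \<Rightarrow> 'a::{linorder,zero,one}) \<Rightarrow> nat \<Rightarrow> nat \<Rightarrow> real" where
  "q_ratio m v k n = fps_nth (H_sum m v k) n / fps_nth (G_all m v) n"

definition p_ratio :: "nat \<Rightarrow> (nat \<Rightarrow> 'a::{linorder,zero,one}) \<Rightarrow> nat \<Rightarrow> nat \<Rightarrow> real" where
  "p_ratio m v k n = real (g_val m v k n) / real (g_all m v n)"

end

theory Submission
  imports Defs
begin

text \<open>
  For \<open>j < m - 1\<close> a formula takes the value \<open>v j\<close> iff it is a variable of that value or an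
  implication whose conclusion has value \<open>v j\<close> and whose premise has a larger value, so
  \<open>G_j = x + H_{j+1} G_j\<close>; also \<open>G = m x + G\<^sup>2\<close>.

  The asymptotics need no singularity analysis. Let \<open>a_n = r^n [x^n] G\<close>. Then \<open>a_{n+1} / a_n \<longrightarrow> 1\<close>,
  \<open>\<Sum>a_n = 1/2\<close> and \<open>a_n = \<Sum>a_i a_{n-i}\<close> for \<open>n \<ge> 2\<close>; hence the two ends \<open>i \<le> K\<close> and \<open>i \<ge> n - K\<close>
  of the convolution carry almost all of it, and the same holds for convolutions of sequences
  dominated by \<open>a\<close>. With \<open>g, h\<close> the scaled coefficients of \<open>G_k, H_{k+1}\<close>, dividing \<open>g = h * g\<close>
  by \<open>a_n\<close> therefore gives, up to a small error, a linear equation that expresses \<open>g_n / a_n\<close> through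
  earlier values of \<open>g / a\<close> and \<open>h / a = (g + h) / a - g / a\<close> with coefficients of total weight at
  most \<open>\<Sum>(g_n + h_n) \<le> 1/2\<close>. If \<open>(g + h) / a\<close> converges this is a contraction, so \<open>g / a\<close> and
  \<open>h / a\<close> converge too, and the limits satisfy the linear equation.
\<close>

section \<open>Functional equations\<close>

text \<open>Labels are used as indices of chain elements: a leaf labelled \<open>i\<close> stands
  for the constant \<open>v i\<close>.\<close>

definition formulas :: "nat \<Rightarrow> formula set" where
  "formulas m = {f. set (leaves f) \<subseteq> {..<m}}"

text \<open>Since \<open>card\<close> of an infinite set is 0, this counts correctly only if each
  number of leaves occurs finitely often, as it does for subsets of
  \<open>formulas m\<close>.\<close>

definition leaf_gf :: "formula set \<Rightarrow> real fps" where
  "leaf_gf X = Abs_fps (\<lambda>n. real (card {f \<in> X. length (leaves f) = n}))"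

lemma leaves_nonempty: "leaves f \<noteq> []"
  by (induction f) auto

text \<open>Every tree has a leaf, so both parts of an implication have fewer leaves than the whole
  and strong induction on \<open>n\<close> applies.\<close>

lemma finite_formulas_length: "finite {f \<in> formulas m. length (leaves f) = n}"
proof (induction n rule: less_induct)
  case (less n)
  let ?S = "\<lambda>n. {f \<in> formulas m. length (leaves f) = n}"
  have "f \<in> Var ` {..<m} \<union> case_prod Imp ` ((\<Union>i<n. ?S i) \<times> (\<Union>i<n. ?S i))" if "f \<in> ?S n" for f
  proof (cases f)
    case (Var i)
    then show ?thesis using that by (auto simp: formulas_def)
  next
    case (Imp a b)
    have "length (leaves a) < n" "length (leaves b) < n" "a \<in> formulas m" "b \<in> formulas m"
      using that Imp leaves_nonempty[of a] leaves_nonempty[of b] by (auto simp: formulas_def)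
    then show ?thesis using Imp by (auto intro!: image_eqI[of _ _ "(a, b)"])
  qed
  then have "?S n \<subseteq> Var ` {..<m} \<union> case_prod Imp ` ((\<Union>i<n. ?S i) \<times> (\<Union>i<n. ?S i))" by blast
  moreover have "finite (\<Union>i<n. ?S i)" using less.IH by (intro finite_UN_I) simp_all
  ultimately show ?case
    by (elim finite_subset)
      (intro finite_UnI finite_imageI finite_cartesian_product, simp_all only: finite_lessThan)
qed

lemma finite_subset_formulas_length:
  "X \<subseteq> formulas m \<Longrightarrow> finite {f \<in> X. length (leaves f) = n}"
  by (rule finite_subset[OF _ finite_formulas_length[of m n]]) blast

lemma leaf_gf_union:
  assumes "finite I" "\<And>i. i \<in> I \<Longrightarrow> X i \<subseteq> formulas m" "disjoint_family_on X I"
  shows "leaf_gf (\<Union>i\<in>I. X i) = (\<Sum>i\<in>I. leaf_gf (X i))"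
proof (rule fps_ext)
  fix n
  have "{f \<in> (\<Union>i\<in>I. X i). length (leaves f) = n} = (\<Union>i\<in>I. {f \<in> X i. length (leaves f) = n})"
    by auto
  also have "card \<dots> = (\<Sum>i\<in>I. card {f \<in> X i. length (leaves f) = n})"
    using assms(1,3) finite_subset_formulas_length[OF assms(2)]
    by (intro card_UN_disjoint) (auto simp: disjoint_family_on_def disjoint_iff)
  finally show "fps_nth (leaf_gf (\<Union>i\<in>I. X i)) n = fps_nth (\<Sum>i\<in>I. leaf_gf (X i)) n"
    by (simp add: leaf_gf_def fps_sum_nth)
qed

lemma leaf_gf_Un:
  assumes "X \<subseteq> formulas m" "Y \<subseteq> formulas m" "X \<inter> Y = {}"
  shows "leaf_gf (X \<union> Y) = leaf_gf X + leaf_gf Y"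
proof (rule fps_ext)
  fix n
  have "{f \<in> X \<union> Y. length (leaves f) = n}
      = {f \<in> X. length (leaves f) = n} \<union> {f \<in> Y. length (leaves f) = n}" by auto
  also have "card \<dots> = card {f \<in> X. length (leaves f) = n} + card {f \<in> Y. length (leaves f) = n}"
    using assms by (intro card_Un_disjoint) (auto simp: finite_subset_formulas_length)
  finally show "fps_nth (leaf_gf (X \<union> Y)) n = fps_nth (leaf_gf X + leaf_gf Y) n"
    by (simp add: leaf_gf_def)
qed

lemma leaf_gf_Var: "leaf_gf (Var ` I) = of_nat (card I) * fps_X"
proof (rule fps_ext)
  fix n
  have "{f \<in> Var ` I. length (leaves f) = n} = (if n = 1 then Var ` I else {})" by auto
  moreover have "card (Var ` I) = card I" by (rule card_image) (auto simp: inj_on_def)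
  ultimately show "fps_nth (leaf_gf (Var ` I)) n = fps_nth (of_nat (card I) * fps_X) n"
    by (simp add: leaf_gf_def fps_X_def)
qed

text \<open>\<open>Imp\<close> is injective and adds the numbers of leaves, so sorting by the leaves
  of the premise yields a Cauchy product.\<close>

lemma leaf_gf_Imp:
  assumes "X \<subseteq> formulas m" "Y \<subseteq> formulas m"
  shows "leaf_gf (case_prod Imp ` (X \<times> Y)) = leaf_gf X * leaf_gf Y"
proof (rule fps_ext)
  fix n
  let ?X = "\<lambda>i. {f \<in> X. length (leaves f) = i}" and ?Y = "\<lambda>i. {f \<in> Y. length (leaves f) = i}"
  have "{f \<in> case_prod Imp ` (X \<times> Y). length (leaves f) = n}
      = case_prod Imp ` (\<Union>i\<in>{0..n}. ?X i \<times> ?Y (n - i))"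
    by (auto simp: image_iff)
  also have "card \<dots> = card (\<Union>i\<in>{0..n}. ?X i \<times> ?Y (n - i))"
    by (rule card_image) (auto simp: inj_on_def)
  also have "\<dots> = (\<Sum>i\<in>{0..n}. card (?X i \<times> ?Y (n - i)))"
    using assms by (intro card_UN_disjoint) (auto simp: finite_subset_formulas_length)
  finally show "fps_nth (leaf_gf (case_prod Imp ` (X \<times> Y))) n = fps_nth (leaf_gf X * leaf_gf Y) n"
    by (simp add: leaf_gf_def fps_mult_nth card_cartesian_product)
qed

section \<open>Valued bracketings as trees with labelled leaves\<close>

fun relabel :: "(nat \<Rightarrow> nat) \<Rightarrow> formula \<Rightarrow> formula" where
  "relabel h (Var i) = Var (h i)"
| "relabel h (Imp a b) = Imp (relabel h a) (relabel h b)"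

text \<open>Forgets the labels and keeps the shape; started at 1 it returns the bracketing
  underlying a tree.\<close>

fun number_leaves :: "formula \<Rightarrow> nat \<Rightarrow> formula" where
  "number_leaves (Var _) i = Var i"
| "number_leaves (Imp a b) i = Imp (number_leaves a i) (number_leaves b (i + length (leaves a)))"

lemma leaves_relabel [simp]: "leaves (relabel h f) = map h (leaves f)"
  by (induction f) auto

lemma truth_relabel [simp]: "truth s (relabel h f) = truth (s \<circ> h) f"
  by (induction f) auto

lemma truth_cong: "(\<And>i. i \<in> set (leaves f) \<Longrightarrow> s i = s' i) \<Longrightarrow> truth s f = truth s' f"
proof (induction f)
  case (Imp a b)
  then have "truth s a = truth s' a" "truth s b = truth s' b" by auto
  then show ?case by simp
qed simp

lemma leaves_number_leaves [simp]:
  "leaves (number_leaves f i) = [i..<i + length (leaves f)]"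
proof (induction f arbitrary: i)
  case (Imp a b)
  then show ?case using upt_add_eq_append[of i "i + length (leaves a)" "length (leaves b)"]
    by (simp add: add.assoc)
qed simp

lemma number_leaves_relabel [simp]: "number_leaves (relabel h f) i = number_leaves f i"
  by (induction f arbitrary: i) auto

lemma number_leaves_id: "leaves f = [i..<i + length (leaves f)] \<Longrightarrow> number_leaves f i = f"
proof (induction f arbitrary: i)
  case (Imp a b)
  then have eq: "leaves a @ leaves b
      = [i..<i + length (leaves a)] @ [i + length (leaves a)..<i + length (leaves a) + length (leaves b)]"
    using upt_add_eq_append[of i "i + length (leaves a)" "length (leaves b)"]
    by (simp add: add.assoc)
  \<comment> \<open>The left pieces of both concatenations have equal length, so the equation
    splits.\<close>
  have "leaves a = [i..<i + length (leaves a)] \<and>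
      leaves b = [i + length (leaves a)..<i + length (leaves a) + length (leaves b)]"
    by (rule iffD1[OF append_eq_append_conv eq]) simp
  then show ?case using Imp.IH(1)[of i] Imp.IH(2)[of "i + length (leaves a)"]
    by (simp only: number_leaves.simps simp_thms)
qed auto

text \<open>Numbering loses only the labels, so any \<open>h\<close> that sends each assigned number
  back to the label at its position restores the tree.\<close>

lemma relabel_number_leaves:
  "(\<And>p. p < length (leaves f) \<Longrightarrow> h (i + p) = leaves f ! p) \<Longrightarrow> relabel h (number_leaves f i) = f"
proof (induction f arbitrary: i)
  case (Var x)
  from Var[of 0] show ?case by simp
next
  case (Imp a b)
  have "h (i + p) = leaves a ! p" if "p < length (leaves a)" for p
    using Imp.prems[of p] that by (simp add: nth_append)
  moreover have "h (i + length (leaves a) + p) = leaves b ! p" if "p < length (leaves b)" for p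
    using Imp.prems[of "length (leaves a) + p"] that by (simp add: nth_append add.assoc)
  ultimately show ?case using Imp.IH by simp
qed

definition val_set :: "nat \<Rightarrow> (nat \<Rightarrow> 'a::{linorder,zero,one}) \<Rightarrow> nat \<Rightarrow> formula set" where
  "val_set m v j = {f \<in> formulas m. truth v f = v j}"

text \<open>
  Substituting values for the variables turns a pair (bracketing, valuation) into a single
  binary tree whose leaves carry values, and every such tree arises exactly once.
\<close>

lemma g_val_eq_card:
  assumes "inj_on v {..<m}"
  shows "g_val m v j n = card {f \<in> val_set m v j. length (leaves f) = n}"
proof -
  \<comment> \<open>Valuations take values in the chain while leaves carry indices; \<open>w\<close>
    translates a value into its index.\<close>
  define w where "w = inv_into {..<m} v"
  have w: "w (v i) = i" if "i < m" for i using assms that by (simp add: w_def)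
  have vw: "v (w x) = x" "w x < m" if "x \<in> v ` {..<m}" for x
    using that w by auto
  define P where "P = {(t, s). t \<in> bracketings n \<and> s \<in> {1..n} \<rightarrow>\<^sub>E v ` {..<m} \<and> truth s t = v j}"
  \<comment> \<open>\<open>F\<close> substitutes the values into the bracketing; its inverse
    \<open>B\<close> reads off shape and labels. Variables count from 1 but list positions from 0,
    hence \<open>i - 1\<close>; the restriction to \<open>{1..n}\<close> makes the valuation
    extensional.\<close>
  define F where "F = (\<lambda>(t, s). relabel (w \<circ> s) t)"
  define B where "B = (\<lambda>f. (number_leaves f 1, \<lambda>i\<in>{1..n}. v (leaves f ! (i - 1))))"
  have "bij_betw F P {f \<in> val_set m v j. length (leaves f) = n}"
  proof (rule bij_betw_byWitness[where f' = B])
    show "\<forall>x\<in>P. B (F x) = x"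
    proof
      fix x assume "x \<in> P"
      then obtain t s where x: "x = (t, s)" and t: "leaves t = [1..<Suc n]"
        and s: "s \<in> {1..n} \<rightarrow>\<^sub>E v ` {..<m}"
        by (auto simp: P_def bracketings_def)
      have "number_leaves t 1 = t" using t by (intro number_leaves_id) simp
      moreover have "(\<lambda>i\<in>{1..n}. v (map (w \<circ> s) [1..<Suc n] ! (i - 1))) = s"
      proof
        fix i
        show "(\<lambda>i\<in>{1..n}. v (map (w \<circ> s) [1..<Suc n] ! (i - 1))) i = s i"
        proof (cases "i \<in> {1..n}")
          case True
          then have "s i \<in> v ` {..<m}" using s by blast
          moreover have "map (w \<circ> s) [1..<Suc n] ! (i - 1) = w (s i)"
            using True by (subst nth_map) (auto simp del: upt_Suc)
          ultimately show ?thesis using True vw(1) by (simp del: upt_Suc One_nat_def)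
        next
          case False
          then show ?thesis using PiE_arb[OF s False] by (simp only: restrict_apply if_False)
        qed
      qed
      ultimately show "B (F x) = x" by (simp add: B_def F_def x t del: upt_Suc)
    qed
    show "\<forall>f\<in>{f \<in> val_set m v j. length (leaves f) = n}. F (B f) = f"
    proof
      fix f assume f: "f \<in> {f \<in> val_set m v j. length (leaves f) = n}"
      then have "set (leaves f) \<subseteq> {..<m}" "length (leaves f) = n"
        by (auto simp: val_set_def formulas_def)
      then have "leaves f ! p < m" if "p < n" for p
        using that by (metis lessThan_iff nth_mem subsetD)
      then show "F (B f) = f"
        unfolding F_def B_def prod.case using \<open>length (leaves f) = n\<close>
        by (intro relabel_number_leaves) (simp add: w)
    qed
    show "F ` P \<subseteq> {f \<in> val_set m v j. length (leaves f) = n}"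
    proof
      fix f assume "f \<in> F ` P"
      then obtain t s where f: "f = relabel (w \<circ> s) t" and t: "leaves t = [1..<Suc n]"
        and s: "s \<in> {1..n} \<rightarrow>\<^sub>E v ` {..<m}" and tr: "truth s t = v j"
        by (auto simp: P_def bracketings_def F_def)
      have si: "s i \<in> v ` {..<m}" if "i \<in> set (leaves t)" for i
        using that s t by (auto simp del: upt_Suc)
      have "truth v f = truth s t"
        unfolding f truth_relabel by (rule truth_cong) (simp add: vw(1)[OF si])
      moreover have "f \<in> formulas m" using vw(2)[OF si] by (auto simp: f formulas_def)
      moreover have "length (leaves f) = n" by (simp add: f t del: upt_Suc)
      ultimately show "f \<in> {f \<in> val_set m v j. length (leaves f) = n}"
        using tr by (simp add: val_set_def)
    qed
    show "B ` {f \<in> val_set m v j. length (leaves f) = n} \<subseteq> P"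
    proof
      fix x assume "x \<in> B ` {f \<in> val_set m v j. length (leaves f) = n}"
      then obtain f where x: "x = B f" and f: "set (leaves f) \<subseteq> {..<m}" "truth v f = v j"
        "length (leaves f) = n"
        by (auto simp: val_set_def formulas_def)
      let ?s = "\<lambda>i\<in>{1..n}. v (leaves f ! (i - 1))"
      have "truth ?s (number_leaves f 1) = truth (v \<circ> (\<lambda>i. leaves f ! (i - 1))) (number_leaves f 1)"
        by (rule truth_cong) (auto simp: f)
      also have "\<dots> = truth v (relabel (\<lambda>i. leaves f ! (i - 1)) (number_leaves f 1))"
        by simp
      also have "relabel (\<lambda>i. leaves f ! (i - 1)) (number_leaves f 1) = f"
        by (rule relabel_number_leaves) simp
      finally have "truth ?s (number_leaves f 1) = v j" by (simp only: f)
      moreover have "leaves f ! (i - 1) \<in> {..<m}" if "i \<in> {1..n}" for i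
      proof -
        have "i - 1 < length (leaves f)" using that f(3) by auto
        then show ?thesis using f(1) nth_mem by blast
      qed
      ultimately show "x \<in> P"
        unfolding P_def B_def x by (simp add: bracketings_def f del: upt_Suc)
    qed
  qed
  then show ?thesis
    unfolding g_val_def P_def[symmetric] by (rule bij_betw_same_card)
qed

text \<open>The coefficient at 0, set to 0 by \<open>gen_fps\<close>, agrees because no tree is
  without leaves.\<close>

lemma G_val_eq_leaf_gf:
  assumes "inj_on v {..<m}"
  shows "G_val m v j = leaf_gf (val_set m v j)"
  by (rule fps_ext)
    (auto simp: G_val_def gen_fps_def leaf_gf_def g_val_eq_card[OF assms] leaves_nonempty not_le)

lemma G_all_eq_sum: "G_all m v = (\<Sum>j<m. G_val m v j)"
  by (rule fps_ext) (auto simp: G_all_def G_val_def gen_fps_def g_all_def fps_sum_nth)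

section \<open>Decomposition of the labelled trees by truth value\<close>

context
  fixes m :: nat and v :: "nat \<Rightarrow> 'a::{linorder,zero,one}"
  assumes chain: "godel_chain m v" and m: "m \<ge> 2"
begin

lemma chain_inj: "inj_on v {..<m}"
  using chain unfolding godel_chain_def by (blast intro: strict_mono_on_imp_inj_on)

lemma chain_less_iff: "i < m \<Longrightarrow> j < m \<Longrightarrow> v i < v j \<longleftrightarrow> i < j"
  using chain unfolding godel_chain_def by (auto simp: strict_mono_on_less)

lemma chain_eq_iff: "i < m \<Longrightarrow> j < m \<Longrightarrow> v i = v j \<longleftrightarrow> i = j"
  using chain_inj by (auto simp: inj_on_def)

text \<open>An implication evaluates to its conclusion or to 1, and 1 is the top element
  \<open>v (m - 1)\<close>.\<close>

lemma truth_in_chain: "f \<in> formulas m \<Longrightarrow> truth v f \<in> v ` {..<m}"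
proof (induction f)
  case (Imp a b)
  have "1 = v (m - 1)" using chain by (simp add: godel_chain_def)
  then have "1 \<in> v ` {..<m}" using m by auto
  then show ?case using Imp by (auto simp: formulas_def godel_imp_def)
qed (auto simp: formulas_def)

lemma val_set_subset: "val_set m v j \<subseteq> formulas m"
  by (auto simp: val_set_def)

lemma disjoint_val_set: "I \<subseteq> {..<m} \<Longrightarrow> disjoint_family_on (val_set m v) I"
  unfolding disjoint_family_on_def
proof (intro ballI impI)
  fix i j assume "I \<subseteq> {..<m}" "i \<in> I" "j \<in> I" "i \<noteq> j"
  then have "v i \<noteq> v j" using chain_eq_iff[of i j] by blast
  then show "val_set m v i \<inter> val_set m v j = {}" by (auto simp: val_set_def)
qed

lemma formulas_eq_UN: "formulas m = (\<Union>j<m. val_set m v j)"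

proof (intro equalityI subsetI)
  fix f assume f: "f \<in> formulas m"
  then obtain j where "j < m" "truth v f = v j" using truth_in_chain[OF f] by auto
  then show "f \<in> (\<Union>j<m. val_set m v j)" using f by (auto simp: val_set_def)
qed (auto simp: val_set_def)

lemma formulas_eq_Un: "formulas m = Var ` {..<m} \<union> case_prod Imp ` (formulas m \<times> formulas m)"
proof -
  have "f \<in> formulas m \<longleftrightarrow> f \<in> Var ` {..<m} \<union> case_prod Imp ` (formulas m \<times> formulas m)" for f
    by (cases f) (auto simp: formulas_def image_iff)
  then show ?thesis by blast
qed

text \<open>As \<open>v j\<close> is not 1, only the second branch of \<open>godel_imp\<close> can
  produce it; the premises allowed there are exactly the trees with a value of larger index.\<close>

lemma val_set_eq_Un:
  assumes "j < m - 1"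
  shows "val_set m v j = Var ` {j} \<union> case_prod Imp ` ((\<Union>i\<in>{j+1..m-1}. val_set m v i) \<times> val_set m v j)"
proof -
  have one: "v j \<noteq> 1"
    using chain_eq_iff[of j "m - 1"] assms chain by (auto simp: godel_chain_def)
  have gt: "a \<in> (\<Union>i\<in>{j+1..m-1}. val_set m v i) \<longleftrightarrow> v j < truth v a" if "a \<in> formulas m" for a
  proof
    assume "a \<in> (\<Union>i\<in>{j+1..m-1}. val_set m v i)"
    then show "v j < truth v a" using chain_less_iff m assms by (auto simp: val_set_def)
  next
    assume *: "v j < truth v a"
    obtain i where "i < m" "truth v a = v i" using truth_in_chain[OF \<open>a \<in> formulas m\<close>] by auto
    then show "a \<in> (\<Union>i\<in>{j+1..m-1}. val_set m v i)"
      using * chain_less_iff[of j i] assms \<open>a \<in> formulas m\<close> by (auto simp: val_set_def)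
  qed
  have "f \<in> val_set m v j \<longleftrightarrow>
      f \<in> Var ` {j} \<union> case_prod Imp ` ((\<Union>i\<in>{j+1..m-1}. val_set m v i) \<times> val_set m v j)" for f
  proof (cases f)
    case (Var i)
    then show ?thesis using chain_eq_iff[of i j] assms by (auto simp: val_set_def formulas_def)
  next
    case (Imp a b)
    have "f \<in> val_set m v j \<longleftrightarrow>
        a \<in> formulas m \<and> b \<in> formulas m \<and> v j < truth v a \<and> truth v b = v j"
      using one Imp by (auto simp: val_set_def formulas_def godel_imp_def)
    also have "\<dots> \<longleftrightarrow> a \<in> (\<Union>i\<in>{j+1..m-1}. val_set m v i) \<and> b \<in> val_set m v j"
      using gt val_set_subset by (auto simp: val_set_def)
    finally show ?thesis using Imp by (auto simp: image_iff)
  qed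
  then show ?thesis by blast
qed

lemma H_sum_eq_leaf_gf:
  "H_sum m v k = leaf_gf (\<Union>i\<in>{k..m-1}. val_set m v i)"
  unfolding H_sum_def G_val_eq_leaf_gf[OF chain_inj] using m
  by (intro leaf_gf_union[symmetric, where m = m] disjoint_val_set val_set_subset) auto

lemma G_val_functional_eq:
  assumes "j < m - 1"
  shows "G_val m v j = fps_X + H_sum m v (j + 1) * G_val m v j"
proof -
  let ?I = "case_prod Imp ` ((\<Union>i\<in>{j+1..m-1}. val_set m v i) \<times> val_set m v j)"
  have "G_val m v j = leaf_gf (Var ` {j} \<union> ?I)"
    using val_set_eq_Un[OF assms] G_val_eq_leaf_gf[OF chain_inj] by metis
  also have "\<dots> = leaf_gf (Var ` {j}) + leaf_gf ?I"
    using val_set_eq_Un[OF assms] val_set_subset by (intro leaf_gf_Un[where m = m]) auto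
  also have "leaf_gf ?I = H_sum m v (j + 1) * G_val m v j"
    unfolding H_sum_eq_leaf_gf G_val_eq_leaf_gf[OF chain_inj]
    using val_set_subset by (intro leaf_gf_Imp) blast+
  also have "leaf_gf (Var ` {j}) = fps_X" unfolding leaf_gf_Var by simp
  finally show ?thesis .
qed

text \<open>Without a condition on the value, premise and conclusion are arbitrary: this is the
  Catalan equation with \<open>m\<close> choices per leaf.\<close>

lemma G_all_functional_eq: "G_all m v = of_nat m * fps_X + G_all m v * G_all m v"
proof -
  let ?I = "case_prod Imp ` (formulas m \<times> formulas m)"
  have G: "G_all m v = leaf_gf (formulas m)"
    unfolding G_all_eq_sum G_val_eq_leaf_gf[OF chain_inj] formulas_eq_UN
    by (intro leaf_gf_union[symmetric, where m = m] disjoint_val_set val_set_subset) auto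
  also have "\<dots> = leaf_gf (Var ` {..<m} \<union> ?I)"
    using formulas_eq_Un by (rule arg_cong)
  also have "\<dots> = leaf_gf (Var ` {..<m}) + leaf_gf ?I"
    using formulas_eq_Un by (intro leaf_gf_Un[where m = m]) auto
  also have "\<dots> = of_nat m * fps_X + G_all m v * G_all m v"
    unfolding leaf_gf_Var leaf_gf_Imp[OF order.refl order.refl] G by simp
  finally show ?thesis .
qed

end

section \<open>Coefficients of the total generating function\<close>

text \<open>With \<open>s n\<close> the partial sums, the recurrence gives
  \<open>s (n + 1) \<le> 1/4 + (s n)\<^sup>2\<close>, and this map sends \<open>[0, 1/2]\<close>
  into itself.\<close>

lemma catalan_like_partial_sum_le:
  fixes a :: "nat \<Rightarrow> real"
  assumes nonneg: "\<And>n. 0 \<le> a n" and a0: "a 0 = 0" and a1: "a 1 = 1/4"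
    and rec: "\<And>n. n \<ge> 2 \<Longrightarrow> a n = (\<Sum>i\<le>n. a i * a (n - i))"
  shows "(\<Sum>i\<le>n. a i) \<le> 1/2"
proof (induction n)
  case (Suc n)
  show ?case
  proof (cases "n = 0")
    case True
    then show ?thesis using a0 a1 by simp
  next
    case False
    have "(\<Sum>k\<le>Suc n. a k) = a 0 + a 1 + (\<Sum>k\<in>{2..Suc n}. a k)"
    proof -
      have "{..Suc n} = {0, 1} \<union> {2..Suc n}" using False by auto
      then show ?thesis by (simp add: sum.union_disjoint)
    qed
    also have "(\<Sum>k\<in>{2..Suc n}. a k) = (\<Sum>k\<in>{2..Suc n}. \<Sum>i\<le>k. a i * a (k - i))"
      using rec by (intro sum.cong) auto
    also have "\<dots> = (\<Sum>(k, i)\<in>(SIGMA k:{2..Suc n}. {1..k-1}). a i * a (k - i))"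
    proof -
      \<comment> \<open>The extreme terms vanish since \<open>a 0 = 0\<close>; for
        \<open>k \<le> n + 1\<close> both remaining indices are then at most
        \<open>n\<close>.\<close>
      have "(\<Sum>i\<le>k. a i * a (k - i)) = (\<Sum>i\<in>{1..k-1}. a i * a (k - i))" for k
      proof (rule sum.mono_neutral_right)
        show "\<forall>i\<in>{..k} - {1..k-1}. a i * a (k - i) = 0"
        proof
          fix i assume "i \<in> {..k} - {1..k-1}"
          then have "i = 0 \<or> i = k" by auto
          then show "a i * a (k - i) = 0" using a0 by auto
        qed
      qed auto
      then show ?thesis by (simp only:) (rule sum.Sigma, auto)
    qed
    \<comment> \<open>The pair \<open>(k, i)\<close> goes to the point \<open>(i, k - i)\<close> of
      the square; the products not reached are nonnegative.\<close>
    also have "\<dots> \<le> (\<Sum>(i, j)\<in>{..n} \<times> {..n}. a i * a j)"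
    proof (rule sum_le_included[where i = "\<lambda>(i, j). (i + j, i)"])
      show "\<forall>x\<in>SIGMA k:{2..Suc n}. {1..k-1}. \<exists>y\<in>{..n} \<times> {..n}. (case y of (i, j) \<Rightarrow> (i + j, i)) = x \<and>
          (case x of (k, i) \<Rightarrow> a i * a (k - i)) \<le> (case y of (i, j) \<Rightarrow> a i * a j)"
      proof
        fix x assume "x \<in> (SIGMA k:{2..Suc n}. {1..k-1})"
        then show "\<exists>y\<in>{..n} \<times> {..n}. (case y of (i, j) \<Rightarrow> (i + j, i)) = x \<and>
            (case x of (k, i) \<Rightarrow> a i * a (k - i)) \<le> (case y of (i, j) \<Rightarrow> a i * a j)"
          by (intro bexI[of _ "(snd x, fst x - snd x)"]) auto
      qed
    qed (auto simp: nonneg)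
    also have "\<dots> = (\<Sum>i\<le>n. a i)\<^sup>2"
      by (simp add: sum_product sum.cartesian_product power2_eq_square)
    also have "\<dots> \<le> (1/2)\<^sup>2"
      using Suc.IH by (intro power_mono sum_nonneg nonneg) auto
    finally show ?thesis using a0 a1 by (simp add: power2_eq_square)
  qed
qed (use a0 in simp)

text \<open>The equation says \<open>(1 - 2 * A)\<^sup>2 = 1 - fps_X\<close>. Evaluating it at 1
  gives the sum; differentiating it gives a linear differential equation, hence a two-term
  recurrence for the coefficients.\<close>

lemma catalan_like_fps:
  fixes A :: "real fps"
  assumes A: "A = fps_const (1/4) * fps_X + A * A" and nonneg: "\<And>n. 0 \<le> fps_nth A n"
    and A0: "fps_nth A 0 = 0"
  shows "summable (fps_nth A)" "(\<Sum>n. fps_nth A n) = 1/2"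
    "(\<lambda>n. fps_nth A (Suc n) / fps_nth A n) \<longlonglongrightarrow> 1" "\<And>n. n \<ge> 1 \<Longrightarrow> 0 < fps_nth A n"
proof -
  let ?a = "fps_nth A"
  have A_nth: "?a n = (if n = 1 then 1/4 else 0) + (\<Sum>i\<le>n. ?a i * ?a (n - i))" for n
    by (subst A) (simp add: fps_mult_nth[of A A] atLeast0AtMost)
  have a1: "?a 1 = 1/4" using A_nth[of 1] A0 by simp
  have rec: "?a n = (\<Sum>i\<le>n. ?a i * ?a (n - i))" if "n \<ge> 2" for n
    using A_nth[of n] that by simp
  show sm: "summable ?a"
  proof (rule summableI_nonneg_bounded)
    show "(\<Sum>i<n. ?a i) \<le> 1/2" for n
      using catalan_like_partial_sum_le[of ?a n] sum_mono2[of "{..n}" "{..<n}" ?a]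
        nonneg A0 a1 rec by force
  qed (use nonneg in auto)
  have sn: "summable (\<lambda>n. norm (?a n))" using sm nonneg by simp
  have "(\<lambda>n. if n = 1 then 1/4 else 0 :: real) sums (1/4)" by (rule sums_single)
  then have "(\<lambda>n. (if n = 1 then 1/4 else 0) + (\<Sum>i\<le>n. ?a i * ?a (n - i)))
      sums (1/4 + suminf ?a * suminf ?a)"
    by (intro sums_add Cauchy_product_sums sn)
  then have "suminf ?a = 1/4 + suminf ?a * suminf ?a"
    using A_nth by (metis (no_types, lifting) ext sums_unique)
  \<comment> \<open>At this point the quadratic has a double root, so no branch has to be
    chosen.\<close>
  then have "(suminf ?a - 1/2)\<^sup>2 = 0" by (simp add: power2_eq_square algebra_simps)
  then show "suminf ?a = 1/2" by simp
  have d: "fps_deriv A = fps_const (1/4) + 2 * A * fps_deriv A"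
    by (subst A) (simp add: algebra_simps)
  have sq: "(1 - 2 * A)\<^sup>2 = 1 - fps_X"
  proof -
    have "(1 - 2 * A)\<^sup>2 = 1 - 4 * A + 4 * (A * A)" by (simp add: power2_eq_square algebra_simps)
    also have "A * A = A - fps_const (1/4) * fps_X" using A by (metis add_diff_cancel_left')
    also have "1 - 4 * A + 4 * (A - fps_const (1/4) * fps_X) = 1 - (4 * fps_const (1/4)) * fps_X"
      by (simp only: algebra_simps)
    also have "4 * fps_const (1/4::real) = 1"
      by (metis fps_const_1_eq_1 fps_const_mult mult.commute nonzero_eq_divide_eq numeral_fps_const zero_neq_numeral)
    finally show ?thesis by simp
  qed
  \<comment> \<open>Multiplying \<open>(1 - 2 * A) * fps_deriv A = fps_const (1/4)\<close> by
    \<open>1 - 2 * A\<close> removes the nonlinear factor on the left.\<close>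
  have "(1 - fps_X) * fps_deriv A = (1 - 2 * A) * (fps_deriv A - 2 * A * fps_deriv A)"
    unfolding sq[symmetric] by (simp add: power2_eq_square algebra_simps)
  also have "fps_deriv A - 2 * A * fps_deriv A = fps_const (1/4)" using d by (simp add: diff_eq_eq)
  finally have ode: "(1 - fps_X) * fps_deriv A = fps_const (1/4) * (1 - 2 * A)" by (simp add: mult.commute)
  \<comment> \<open>Coefficient comparison in \<open>ode\<close>; \<open>n \<ge> 1\<close> excludes
    the constant term 1 on its right.\<close>
  have ratio: "?a (Suc n) = (real n - 1/2) / real (Suc n) * ?a n" if "n \<ge> 1" for n
  proof -
    have "fps_nth ((1 - fps_X) * fps_deriv A) n = fps_nth (fps_const (1/4) * (1 - 2 * A)) n"
      by (simp only: ode)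
    moreover have "fps_nth (2 * A) n = 2 * ?a n" by (simp add: numeral_fps_const)
    ultimately have "real (Suc n) * ?a (Suc n) - real n * ?a n = - ?a n / 2"
      using that by (cases n) (auto simp: left_diff_distrib)
    then show ?thesis by (simp add: field_simps)
  qed
  show pos: "0 < ?a n" if "n \<ge> 1" for n
    using that
  proof (induction n rule: dec_induct)
    case (step n)
    then have "0 < (real n - 1/2) / real (Suc n) * ?a n" by (intro mult_pos_pos divide_pos_pos) auto
    then show ?case using ratio[of n] step.hyps by simp
  qed (use a1 in simp)
  have "(\<lambda>n. 1 - 3/2 * inverse (real (Suc n))) \<longlonglongrightarrow> 1 - 3/2 * 0"
    by (intro tendsto_intros LIMSEQ_inverse_real_of_nat)
  also have "(\<lambda>n. 1 - 3/2 * inverse (real (Suc n))) = (\<lambda>n. (real n - 1/2) / real (Suc n))"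
    by (auto simp: field_simps)
  finally have "(\<lambda>n. (real n - 1/2) / real (Suc n)) \<longlonglongrightarrow> 1" by simp
  then show "(\<lambda>n. ?a (Suc n) / ?a n) \<longlonglongrightarrow> 1"
    by (rule Lim_transform_eventually)
      (use ratio pos in \<open>auto intro!: eventually_sequentiallyI[of 1] simp: less_imp_neq[symmetric]\<close>)
qed

section \<open>Ratio limits\<close>

lemma sum_atMost_split_ends:
  fixes F :: "nat \<Rightarrow> real"
  assumes "2 * K < n"
  shows "(\<Sum>i\<le>n. F i) = (\<Sum>k\<le>K. F k) + (\<Sum>k\<le>K. F (n - k)) + (\<Sum>i\<in>{K<..<n-K}. F i)"
proof -
  have "(\<Sum>k\<le>K. F (n - k)) = (\<Sum>i\<in>{n-K..n}. F i)"
    using assms by (intro sum.reindex_bij_witness[of _ "\<lambda>i. n - i" "\<lambda>k. n - k"]) auto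
  moreover have "{..n} = ({..K} \<union> {n-K..n}) \<union> {K<..<n-K}" using assms by auto
  moreover have "(\<Sum>i\<in>({..K} \<union> {n-K..n}) \<union> {K<..<n-K}. F i)
      = (\<Sum>i\<in>{..K}. F i) + (\<Sum>i\<in>{n-K..n}. F i) + (\<Sum>i\<in>{K<..<n-K}. F i)"
    using assms by (subst sum.union_disjoint; (subst sum.union_disjoint)?) auto
  ultimately show ?thesis by simp
qed

text \<open>The difference \<open>a - f\<close> is nonnegative, so its partial sums stay below its
  total. Tails of dominated sequences are thus small along with the tail of
  \<open>a\<close>.\<close>

lemma suminf_tail_mono:
  fixes f a :: "nat \<Rightarrow> real"
  assumes "summable f" "summable a" "\<And>n. f n \<le> a n"
  shows "suminf f - (\<Sum>k\<le>K. f k) \<le> suminf a - (\<Sum>k\<le>K. a k)"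
proof -
  have "(\<Sum>k\<le>K. a k - f k) \<le> (\<Sum>n. a n - f n)"
    using assms by (intro sum_le_suminf summable_diff) auto
  then show ?thesis using assms by (simp add: suminf_diff[symmetric] sum_subtractf)
qed

text \<open>Starting from the bound \<open>\<bar>B\<bar> + 1\<close>, repeated use of
  \<open>contr\<close> gives the eventual bounds \<open>c ^ j * (\<bar>B\<bar> + 1)\<close>. This
  avoids working with an upper limit.\<close>

lemma tendsto_0_of_contraction:
  fixes x :: "nat \<Rightarrow> real"
  assumes "\<And>n. \<bar>x n\<bar> \<le> B" "0 \<le> c" "c < 1"
    and contr: "\<And>M. 0 < M \<Longrightarrow> eventually (\<lambda>n. \<bar>x n\<bar> \<le> M) sequentially
      \<Longrightarrow> eventually (\<lambda>n. \<bar>x n\<bar> \<le> c * M) sequentially"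
  shows "x \<longlonglongrightarrow> 0"
proof -
  have bound: "eventually (\<lambda>n. \<bar>x n\<bar> \<le> \<bar>B\<bar> + 1) sequentially"
  proof (intro always_eventually allI)
    show "\<bar>x n\<bar> \<le> \<bar>B\<bar> + 1" for n using assms(1)[of n] by linarith
  qed
  show ?thesis
  \<comment> \<open>\<open>contr\<close> accepts positive bounds only, so it cannot be iterated when
    \<open>c = 0\<close>; one application then suffices.\<close>
  proof (cases "c = 0")
    case True
    from contr[OF _ bound] True have "eventually (\<lambda>n. x n = 0) sequentially" by simp
    then show ?thesis by (rule tendsto_eventually)
  next
    case False
    then have c: "0 < c" using assms by simp
    have ev: "eventually (\<lambda>n. \<bar>x n\<bar> \<le> c ^ j * (\<bar>B\<bar> + 1)) sequentially" for j
    proof (induction j)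
      case 0
      show ?case using bound by simp
    next
      case (Suc j)
      have "0 < c ^ j * (\<bar>B\<bar> + 1)" using c by (intro mult_pos_pos) auto
      from contr[OF this Suc.IH] show ?case by (simp add: mult.assoc)
    qed
    show ?thesis
    proof (rule tendstoI)
      fix e :: real assume "0 < e"
      have "(\<lambda>j. c ^ j * (\<bar>B\<bar> + 1)) \<longlonglongrightarrow> 0 * (\<bar>B\<bar> + 1)"
        using assms by (intro tendsto_intros LIMSEQ_realpow_zero) auto
      then have "eventually (\<lambda>j. c ^ j * (\<bar>B\<bar> + 1) < e) sequentially"
        using \<open>0 < e\<close> by (intro order_tendstoD(2)) auto
      then obtain j where "c ^ j * (\<bar>B\<bar> + 1) < e" using eventually_happens sequentially_bot by blast
      then show "eventually (\<lambda>n. dist (x n) 0 < e) sequentially"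
        using ev[of j] by (auto elim!: eventually_mono)
    qed
qed
qed

section \<open>Convolutions of sequences dominated by \<open>a\<close>\<close>

context
  fixes a :: "nat \<Rightarrow> real"
  assumes nonneg: "\<And>n. 0 \<le> a n" and pos: "\<And>n. n \<ge> 1 \<Longrightarrow> 0 < a n"
    and rec: "\<And>n. n \<ge> 2 \<Longrightarrow> a n = (\<Sum>i\<le>n. a i * a (n - i))"
    and sm: "summable a" and half: "suminf a = 1/2"
    and ratio: "(\<lambda>n. a (Suc n) / a n) \<longlonglongrightarrow> 1"
begin

text \<open>A product of \<open>k\<close> consecutive ratios; the induction uses
  \<open>n + k\<close> to stay clear of truncated subtraction.\<close>

lemma ratio_shift: "(\<lambda>n. a (n - k) / a n) \<longlonglongrightarrow> 1"
proof -
  have inv: "(\<lambda>n. a n / a (Suc n)) \<longlonglongrightarrow> 1"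
    using tendsto_inverse[OF ratio] by simp
  have "(\<lambda>n. a n / a (n + k)) \<longlonglongrightarrow> 1"
  proof (induction k)
    case 0
    show ?case
      by (rule tendsto_eventually)
        (use pos in \<open>force intro!: eventually_sequentiallyI[of 1] simp: less_imp_neq[symmetric]\<close>)
  next
    case (Suc k)
    have "(\<lambda>n. (a n / a (n + k)) * (a (n + k) / a (Suc (n + k)))) \<longlonglongrightarrow> 1 * 1"
      by (intro tendsto_mult Suc.IH LIMSEQ_ignore_initial_segment[OF inv])
    then have "(\<lambda>n. (a n / a (n + k)) * (a (n + k) / a (Suc (n + k)))) \<longlonglongrightarrow> 1" by simp
    then show ?case
    proof (rule Lim_transform_eventually)
      show "eventually (\<lambda>n. (a n / a (n + k)) * (a (n + k) / a (Suc (n + k))) = a n / a (n + Suc k))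
          sequentially"
      proof (rule eventually_sequentiallyI[of 1])
        fix n :: nat assume "1 \<le> n"
        then have "0 < a (n + k)" by (intro pos) simp
        then show "(a n / a (n + k)) * (a (n + k) / a (Suc (n + k))) = a n / a (n + Suc k)" by simp
      qed
    qed
  qed
  then have "(\<lambda>n. a ((n + k) - k) / a (n + k)) \<longlonglongrightarrow> 1" by simp
  then show ?thesis by (rule LIMSEQ_offset)
qed

text \<open>Factor \<open>f (n - k) / a n\<close> as \<open>f (n - k) / a (n - k)\<close> times
  \<open>a (n - k) / a n\<close>. The first factor is at most 1 and eventually within
  \<open>M\<close> of \<open>L\<close>, the second tends to 1; only finitely many \<open>k\<close>
  are involved.\<close>

lemma eventually_shifted_close:
  fixes f :: "nat \<Rightarrow> real"
  assumes f: "\<And>n. 0 \<le> f n" "\<And>n. f n \<le> a n" and "0 < \<eta>"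
    and ev: "eventually (\<lambda>n. \<bar>f n / a n - L\<bar> \<le> M) sequentially"
  shows "eventually (\<lambda>n. \<forall>k\<in>{..K}. \<bar>f (n - k) / a n - L\<bar> \<le> M + \<eta>) sequentially"
proof (rule eventually_ball_finite)
  show "\<forall>k\<in>{..K}. eventually (\<lambda>n. \<bar>f (n - k) / a n - L\<bar> \<le> M + \<eta>) sequentially"
  proof
    fix k
    obtain N where N: "\<And>n. n \<ge> N \<Longrightarrow> \<bar>f n / a n - L\<bar> \<le> M"
      using ev by (auto simp: eventually_sequentially)
    have "eventually (\<lambda>n. dist (a (n - k) / a n) 1 < \<eta>) sequentially"
      using ratio_shift \<open>0 < \<eta>\<close> by (rule tendstoD)
    then show "eventually (\<lambda>n. \<bar>f (n - k) / a n - L\<bar> \<le> M + \<eta>) sequentially"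
      using eventually_ge_at_top[of "N + k + 1"]
    proof eventually_elim
      case (elim n)
      have p: "0 < a (n - k)" using elim by (intro pos) simp
      define E \<rho> T where "E = f (n - k) / a (n - k)" and "\<rho> = a (n - k) / a n"
        and "T = E * (\<rho> - 1)"
      have E: "0 \<le> E" "E \<le> 1" using f p by (auto simp: E_def)
      have eq: "f (n - k) / a n = E + T"
        using p by (simp add: T_def E_def \<rho>_def right_diff_distrib)
      have "\<bar>T\<bar> \<le> 1 * \<bar>\<rho> - 1\<bar>"
        unfolding T_def abs_mult using E by (intro mult_right_mono) auto
      moreover have "\<bar>E - L\<bar> \<le> M" using N[of "n - k"] elim by (simp add: E_def)
      moreover have "\<bar>\<rho> - 1\<bar> < \<eta>" using elim by (simp add: \<rho>_def dist_real_def)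
      moreover have "\<bar>E + T - L\<bar> \<le> \<bar>E - L\<bar> + \<bar>T\<bar>"
        using abs_triangle_ineq[of "E - L" T] by (simp add: algebra_simps)
      ultimately have "\<bar>E + T - L\<bar> \<le> M + \<eta>" by simp
      then show ?case by (simp only: eq)
    qed
  qed
qed simp

text \<open>What remains between the ends is nonnegative and bounded by the middle of
  \<open>a\<close> convolved with itself, which \<open>rec\<close> evaluates as \<open>a n\<close>
  minus its two ends. Divided by \<open>a n\<close>, the bound tends to
  \<open>1 - 2 * (\<Sum>k\<le>K. a k)\<close>, which is small for large \<open>K\<close> because
  \<open>a\<close> sums to 1/2.\<close>

lemma convolution_middle_bound:
  fixes f g :: "nat \<Rightarrow> real"
  assumes "\<And>n. 0 \<le> f n" "\<And>n. f n \<le> a n" "\<And>n. 0 \<le> g n" "\<And>n. g n \<le> a n"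
    and n: "2 * K < n" "2 \<le> n"
  shows "\<bar>(\<Sum>i\<le>n. f i * g (n - i)) - (\<Sum>k\<le>K. f k * g (n - k) + g k * f (n - k))\<bar>
    \<le> a n - 2 * (\<Sum>k\<le>K. a k * a (n - k))"
proof -
  have split: "(\<Sum>i\<le>n. f i * g (n - i))
      = (\<Sum>k\<le>K. f k * g (n - k) + g k * f (n - k)) + (\<Sum>i\<in>{K<..<n-K}. f i * g (n - i))"
    for f g :: "nat \<Rightarrow> real"
  proof -
    have "(\<Sum>k\<le>K. f (n - k) * g (n - (n - k))) = (\<Sum>k\<le>K. g k * f (n - k))"
      using n by (intro sum.cong) auto
    then show ?thesis
      using sum_atMost_split_ends[OF n(1), of "\<lambda>i. f i * g (n - i)"] by (simp add: sum.distrib)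
  qed
  have "(\<Sum>i\<in>{K<..<n-K}. f i * g (n - i)) \<le> (\<Sum>i\<in>{K<..<n-K}. a i * a (n - i))"
    using assms nonneg by (intro sum_mono mult_mono) auto
  moreover have "0 \<le> (\<Sum>i\<in>{K<..<n-K}. f i * g (n - i))"
    using assms by (intro sum_nonneg mult_nonneg_nonneg) auto
  moreover have "a n = 2 * (\<Sum>k\<le>K. a k * a (n - k)) + (\<Sum>i\<in>{K<..<n-K}. a i * a (n - i))"
    using rec[OF n(2)] split[of a a] by (simp add: sum_distrib_left)
  ultimately show ?thesis using split[of f g] by linarith
qed

text \<open>The value \<open>e\<close> is forced: limits \<open>e\<close> of \<open>g / a\<close>
  and \<open>q - e\<close> of \<open>h / a\<close> must satisfy
  \<open>e = suminf h * e + suminf g * (q - e)\<close>.\<close>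

lemma ratio_limit_step:
  fixes h g :: "nat \<Rightarrow> real"
  assumes h: "\<And>n. 0 \<le> h n" and g: "\<And>n. 0 \<le> g n" and hg: "\<And>n. h n + g n \<le> a n"
    and g_rec: "\<And>n. n \<ge> 2 \<Longrightarrow> g n = (\<Sum>i\<le>n. h i * g (n - i))"
    and q: "(\<lambda>n. (h n + g n) / a n) \<longlonglongrightarrow> q"
  defines "e \<equiv> q * suminf g / (1 - suminf h + suminf g)"
  shows "(\<lambda>n. g n / a n) \<longlonglongrightarrow> e" "(\<lambda>n. h n / a n) \<longlonglongrightarrow> q - e"
proof -
  have ha: "h n \<le> a n" and ga: "g n \<le> a n" for n
    using h[of n] g[of n] hg[of n] by linarith+
  have smh: "summable h" by (rule summable_comparison_test'[OF sm, of 0]) (use h ha in auto)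
  have smg: "summable g" by (rule summable_comparison_test'[OF sm, of 0]) (use g ga in auto)
  have "suminf h + suminf g \<le> 1/2"
    unfolding half[symmetric] suminf_add[OF smh smg] by (intro suminf_le hg summable_add smh smg sm)
  moreover have g0: "0 \<le> suminf g" by (intro suminf_nonneg smg g)
  ultimately have den: "0 < 1 - suminf h + suminf g" by linarith
  define d where "d = q - e"
  define C where "C = \<bar>e\<bar> + \<bar>d\<bar>"
  have "e * (1 - suminf h + suminf g) = q * suminf g" using den by (simp add: e_def)
  then have fixpoint: "e = suminf h * e + suminf g * d" by (simp add: d_def algebra_simps)
  have "(\<lambda>n. g n / a n - e) \<longlonglongrightarrow> 0"
  \<comment> \<open>The total weight 1/2 acts on deviations of at most \<open>M + M/8\<close>,
    giving \<open>9/16 * M\<close>; the other errors add \<open>M/16\<close>, which stays below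
    \<open>3/4 * M\<close>.\<close>
  proof (rule tendsto_0_of_contraction[where c = "3/4" and B = "1 + \<bar>e\<bar>"])
    fix n
    have "0 \<le> g n / a n" "g n / a n \<le> 1"
      using g[of n] ga[of n] nonneg[of n] by (auto simp: divide_le_eq_1)
    then show "\<bar>g n / a n - e\<bar> \<le> 1 + \<bar>e\<bar>" by linarith
  next
    fix M :: real assume M: "0 < M" and evM: "eventually (\<lambda>n. \<bar>g n / a n - e\<bar> \<le> M) sequentially"
    \<comment> \<open>The middle of the convolution will cost at most \<open>\<eta>\<close> and the
      cut-off tails at most \<open>C * \<eta>\<close>, together \<open>M/16\<close>.\<close>
    define \<eta> where "\<eta> = M / (16 * (1 + C))"
    have C: "0 \<le> C" by (simp add: C_def)
    have \<eta>: "0 < \<eta>" "(1 + C) * \<eta> = M / 16" using M C by (auto simp: \<eta>_def field_simps)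
    have "(\<lambda>n. \<Sum>k\<le>n. a k) \<longlonglongrightarrow> 1/2" using summable_LIMSEQ'[OF sm] half by simp
    then have "eventually (\<lambda>K. 1/2 - \<eta>/2 < (\<Sum>k\<le>K. a k)) sequentially"
      using \<eta> by (intro order_tendstoD(1)) auto
    \<comment> \<open>One \<open>K\<close> serves twice: it bounds the tails of \<open>g\<close> and
      \<open>h\<close>, and it makes the two ends carry more than \<open>1 - \<eta>\<close> of the
      convolution in the limit.\<close>
    then obtain K where K: "1/2 - \<eta>/2 < (\<Sum>k\<le>K. a k)"
      using eventually_happens sequentially_bot by blast
    have "(\<lambda>n. 2 * (\<Sum>k\<le>K. a k * (a (n - k) / a n))) \<longlonglongrightarrow> 2 * (\<Sum>k\<le>K. a k * 1)"
      by (intro tendsto_intros ratio_shift)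
    then have ev1: "eventually (\<lambda>n. 1 - \<eta> < 2 * (\<Sum>k\<le>K. a k * (a (n - k) / a n))) sequentially"
      by (rule order_tendstoD(1)) (use K in simp)
    have ev2: "eventually (\<lambda>n. \<forall>k\<in>{..K}. \<bar>g (n - k) / a n - e\<bar> \<le> M + M/8) sequentially"
      using M by (intro eventually_shifted_close g ga evM) auto
    have "eventually (\<lambda>n. dist ((h n + g n) / a n) q < M/16) sequentially"
      using q M by (intro tendstoD) auto
    with evM have "eventually (\<lambda>n. \<bar>h n / a n - d\<bar> \<le> M + M/16) sequentially"
    proof eventually_elim
      case (elim n)
      then show ?case unfolding d_def dist_real_def add_divide_distrib by linarith
    qed
    then have "eventually (\<lambda>n. \<forall>k\<in>{..K}. \<bar>h (n - k) / a n - d\<bar> \<le> (M + M/16) + M/16) sequentially"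
      using M by (intro eventually_shifted_close h ha) auto
    with ev1 ev2 show "eventually (\<lambda>n. \<bar>g n / a n - e\<bar> \<le> 3/4 * M) sequentially"
      using eventually_gt_at_top[of "2 * K + 1"]
    proof eventually_elim
      case (elim n)
      then have n: "2 * K < n" "2 \<le> n" by auto
      have an: "0 < a n" using n by (intro pos) simp
      \<comment> \<open>\<open>R\<close> is the middle of the convolution, \<open>S\<close> the
        deviation of the ends from the expected limits, and \<open>th\<close>, \<open>tg\<close> are
        what truncation at \<open>K\<close> removes from \<open>fixpoint\<close>.\<close>
      define R where "R = g n - (\<Sum>k\<le>K. h k * g (n - k) + g k * h (n - k))"
      define S where "S = (\<Sum>k\<le>K. h k * (g (n - k) / a n - e) + g k * (h (n - k) / a n - d))"
      define th tg where "th = suminf h - (\<Sum>k\<le>K. h k)" and "tg = suminf g - (\<Sum>k\<le>K. g k)"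
      have "\<bar>R\<bar> \<le> a n - 2 * (\<Sum>k\<le>K. a k * a (n - k))"
        unfolding R_def using g_rec[OF n(2)] convolution_middle_bound[OF h ha g ga n] by simp
      then have "\<bar>R\<bar> / a n \<le> (a n - 2 * (\<Sum>k\<le>K. a k * a (n - k))) / a n"
        using an by (intro divide_right_mono) auto
      also have "\<dots> = 1 - 2 * (\<Sum>k\<le>K. a k * (a (n - k) / a n))"
        using an by (simp add: diff_divide_distrib sum_divide_distrib[symmetric])
      finally have R: "\<bar>R / a n\<bar> \<le> \<eta>" using elim(1) an by (simp add: abs_divide)
      have "\<bar>S\<bar> \<le> (\<Sum>k\<le>K. (h k + g k) * (M + M/8))"
        unfolding S_def
      proof (rule order_trans[OF sum_abs], rule sum_mono)
        fix k assume k: "k \<in> {..K}"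
        have "\<bar>h k * (g (n - k) / a n - e)\<bar> \<le> h k * (M + M/8)"
          unfolding abs_mult using h[of k] elim(2) k by (intro mult_mono) auto
        moreover have "\<bar>g k * (h (n - k) / a n - d)\<bar> \<le> g k * (M + M/8)"
          unfolding abs_mult using g[of k] bspec[OF elim(3) k] by (intro mult_mono) auto
        ultimately show "\<bar>h k * (g (n - k) / a n - e) + g k * (h (n - k) / a n - d)\<bar>
            \<le> (h k + g k) * (M + M/8)"
          unfolding distrib_right by linarith
      qed
      also have "\<dots> = (\<Sum>k\<le>K. h k + g k) * (M + M/8)" by (rule sum_distrib_right[symmetric])
      also have "\<dots> \<le> 1/2 * (M + M/8)"
      proof (rule mult_right_mono)
        have "(\<Sum>k\<le>K. h k + g k) \<le> (\<Sum>k\<le>K. a k)" by (intro sum_mono hg)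
        also have "\<dots> \<le> suminf a" by (intro sum_le_suminf sm nonneg) auto
        finally show "(\<Sum>k\<le>K. h k + g k) \<le> 1/2" by (simp add: half)
      qed (use M in simp)
      finally have S: "\<bar>S\<bar> \<le> 1/2 * (M + M/8)" .
      have "0 \<le> th" "0 \<le> tg"
        unfolding th_def tg_def using sum_le_suminf[OF smh, of "{..K}"] sum_le_suminf[OF smg, of "{..K}"] h g
        by auto
      moreover have "th \<le> \<eta>" "tg \<le> \<eta>"
        using suminf_tail_mono[OF smh sm ha, of K] suminf_tail_mono[OF smg sm ga, of K] K \<eta> half
        unfolding th_def tg_def by linarith+
      ultimately have "\<bar>th * e\<bar> \<le> \<eta> * \<bar>e\<bar>" "\<bar>tg * d\<bar> \<le> \<eta> * \<bar>d\<bar>"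
        unfolding abs_mult by (auto intro!: mult_right_mono)
      then have t: "\<bar>th * e\<bar> + \<bar>tg * d\<bar> \<le> C * \<eta>" unfolding C_def by (simp add: algebra_simps)
      have "S = (\<Sum>k\<le>K. h k * g (n - k) + g k * h (n - k)) / a n - (\<Sum>k\<le>K. h k) * e - (\<Sum>k\<le>K. g k) * d"
        unfolding S_def
        by (simp add: sum.distrib sum_subtractf sum_divide_distrib sum_distrib_right
            right_diff_distrib add_divide_distrib)
      then have "g n / a n = S + (\<Sum>k\<le>K. h k) * e + (\<Sum>k\<le>K. g k) * d + R / a n"
        unfolding R_def by (simp add: diff_divide_distrib)
      moreover have "e = (\<Sum>k\<le>K. h k) * e + (\<Sum>k\<le>K. g k) * d + th * e + tg * d"
        using fixpoint unfolding th_def tg_def by (simp add: algebra_simps)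
      ultimately have "g n / a n - e = S + R / a n - th * e - tg * d" by linarith
      then have "\<bar>g n / a n - e\<bar> \<le> 1/2 * (M + M/8) + \<eta> + C * \<eta>" using S R t by linarith
      also have "\<dots> = 1/2 * (M + M/8) + (1 + C) * \<eta>" by (simp only: distrib_right mult_1 add.assoc)
      also have "\<dots> \<le> 3/4 * M" unfolding \<eta>(2) using M by simp
      finally show ?case .
    qed
  qed auto
  then show lim_g: "(\<lambda>n. g n / a n) \<longlonglongrightarrow> e" by (simp add: LIM_zero_iff)
  show "(\<lambda>n. h n / a n) \<longlonglongrightarrow> q - e"
    using tendsto_diff[OF q lim_g] by (simp add: add_divide_distrib)
qed

end

section \<open>Scaled coefficients at the critical point\<close>

lemma fps_mult_nth_scaled:
  "fps_nth (F * G) n * c ^ n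
    = (\<Sum>i\<le>n. (fps_nth F i * c ^ i) * (fps_nth G (n - i) * c ^ (n - i)))" for F G :: "real fps"
proof -
  have "fps_nth F i * fps_nth G (n - i) * c ^ n
      = (fps_nth F i * c ^ i) * (fps_nth G (n - i) * c ^ (n - i))" if "i \<le> n" for i
    using power_add[of c i "n - i"] that by simp
  then show ?thesis
    unfolding fps_mult_nth atLeast0AtMost sum_distrib_right by (intro sum.cong) simp_all
qed

lemma summable_power_of_nonneg:
  fixes f :: "nat \<Rightarrow> real"
  assumes "\<And>n. 0 \<le> f n" "summable (\<lambda>n. f n * r ^ n)" "\<bar>x\<bar> \<le> r"
  shows "summable (\<lambda>n. f n * x ^ n)"
proof (rule summable_comparison_test'[OF assms(2)])
  fix n
  have "\<bar>x\<bar> ^ n \<le> r ^ n" using assms by (intro power_mono) auto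
  then show "norm (f n * x ^ n) \<le> f n * r ^ n"
    using assms by (simp add: abs_mult power_abs mult_left_mono)
qed

lemma Phi_has_derivative:
  "u \<noteq> 1 \<Longrightarrow> (Phi r has_real_derivative 1 + r / (1 - u)\<^sup>2) (at u)"
  unfolding Phi_def[abs_def]
  by (auto intro!: derivative_eq_intros simp: power2_eq_square)

lemma G_val_nonneg: "0 \<le> fps_nth (G_val m v j) n"
  by (simp add: G_val_def gen_fps_def)

lemma H_sum_nonneg: "0 \<le> fps_nth (H_sum m v k) n"
  by (simp add: H_sum_def fps_sum_nth sum_nonneg G_val_nonneg)

text \<open>For \<open>k = m - 1\<close> the last sum is empty.\<close>

lemma H_sum_rec: "k \<le> m - 1 \<Longrightarrow> H_sum m v k = G_val m v k + H_sum m v (k + 1)"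
  unfolding H_sum_def by (simp add: sum.atLeast_Suc_atMost)

lemma H_sum_0: "m \<ge> 1 \<Longrightarrow> H_sum m v 0 = G_all m v"
proof -
  assume "m \<ge> 1"
  then have "{0..m-1} = {..<m}" by auto
  then show ?thesis by (simp add: H_sum_def G_all_eq_sum)
qed

lemma H_sum_le_G_all: "m \<ge> 1 \<Longrightarrow> fps_nth (H_sum m v k) n \<le> fps_nth (G_all m v) n"
  unfolding H_sum_def G_all_eq_sum fps_sum_nth
  by (intro sum_mono2) (auto simp: G_val_nonneg)

lemma p_ratio_eq:
  assumes "n \<ge> 1"
  shows "p_ratio m v k n = fps_nth (G_val m v k) n / fps_nth (G_all m v) n"
  using assms by (simp add: p_ratio_def G_val_def G_all_def gen_fps_def)

context
  fixes m :: nat and v :: "nat \<Rightarrow> 'a::{linorder,zero,one}" and r :: real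
  assumes chain: "godel_chain m v" and m: "m \<ge> 2" and r: "r = 1 / (4 * real m)"
begin

lemma r_pos: "0 < r" using m r by simp

text \<open>The scaling turns \<open>m * x\<close> into \<open>x / 4\<close>, so
  \<open>catalan_like_fps\<close> applies. The facts come in the order of the assumptions on
  \<open>a\<close> in \<open>ratio_limit_step\<close>.\<close>

lemma G_all_scaled:
  defines "a \<equiv> (\<lambda>n. fps_nth (G_all m v) n * r ^ n)"
  shows "0 \<le> a n" and "n \<ge> 1 \<Longrightarrow> 0 < a n"
    and "n \<ge> 2 \<Longrightarrow> a n = (\<Sum>i\<le>n. a i * a (n - i))"
    and "summable a" and "suminf a = 1/2" and "(\<lambda>n. a (Suc n) / a n) \<longlonglongrightarrow> 1"
proof -
  define A where "A = Abs_fps a"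
  have A_nth: "fps_nth A = a" by (simp add: A_def fun_eq_iff)
  have a_eq: "a n = (if n = 1 then 1/4 else 0) + (\<Sum>i\<le>n. a i * a (n - i))" for n
  proof -
    have "a n = fps_nth (of_nat m * fps_X + G_all m v * G_all m v) n * r ^ n"
      unfolding a_def using G_all_functional_eq[OF chain m] by metis
    also have "\<dots> = fps_nth (of_nat m * fps_X) n * r ^ n + (\<Sum>i\<le>n. a i * a (n - i))"
      unfolding fps_add_nth distrib_right fps_mult_nth_scaled a_def ..
    also have "fps_nth (of_nat m * fps_X :: real fps) n * r ^ n = (if n = 1 then 1/4 else 0)"
      using m r by (simp add: fps_X_def)
    finally show ?thesis .
  qed
  have A: "A = fps_const (1/4) * fps_X + A * A"
  proof (rule fps_ext)
    fix n
    show "fps_nth A n = fps_nth (fps_const (1/4) * fps_X + A * A) n"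
      using a_eq[of n] by (simp add: fps_mult_nth[of A A] A_nth atLeast0AtMost fps_X_def)
  qed
  show nonneg: "0 \<le> a n" for n
    using H_sum_nonneg[of m v 0 n] r_pos m by (simp add: a_def H_sum_0)
  have "fps_nth A 0 = 0" by (simp add: A_nth a_def G_all_def gen_fps_def)
  note * = catalan_like_fps[OF A, unfolded A_nth, OF nonneg this[unfolded A_nth]]
  show "summable a" "suminf a = 1/2" "(\<lambda>n. a (Suc n) / a n) \<longlonglongrightarrow> 1"
    and "n \<ge> 1 \<Longrightarrow> 0 < a n"
    using * by auto
  show "n \<ge> 2 \<Longrightarrow> a n = (\<Sum>i\<le>n. a i * a (n - i))" using a_eq[of n] by simp
qed

lemma summable_H_sum: "summable (\<lambda>n. fps_nth (H_sum m v k) n * r ^ n)"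
  by (rule summable_comparison_test'[OF G_all_scaled(4), of 0])
    (use H_sum_le_G_all[of m v k] r_pos m in
      \<open>auto simp: abs_mult abs_of_nonneg[OF H_sum_nonneg] intro!: mult_right_mono\<close>)

lemma summable_G_val:
  assumes "j < m"
  shows "summable (\<lambda>n. fps_nth (G_val m v j) n * r ^ n)"
proof (rule summable_comparison_test'[OF summable_H_sum[of j], of 0])
  fix n
  have "fps_nth (G_val m v j) n \<le> fps_nth (H_sum m v j) n"
    using H_sum_rec[of j m v] assms H_sum_nonneg[of m v "j + 1" n] by simp
  then show "norm (fps_nth (G_val m v j) n * r ^ n) \<le> fps_nth (H_sum m v j) n * r ^ n"
    using r_pos by (auto simp: abs_mult G_val_nonneg intro!: mult_right_mono)
qed

text \<open>Keeps the arguments of \<open>Phi r\<close> away from its pole at 1.\<close>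

lemma eval_H_sum_le: "eval_fps (H_sum m v k) r \<le> 1/2"
  unfolding eval_fps_def G_all_scaled(5)[symmetric]
  using H_sum_le_G_all[of m v k] m r_pos
  by (intro suminf_le summable_H_sum G_all_scaled(4)) (auto intro!: mult_right_mono)

lemma eval_H_sum_rec:
  assumes "k < m"
  shows "eval_fps (H_sum m v k) r = eval_fps (G_val m v k) r + eval_fps (H_sum m v (k + 1)) r"
  using assms H_sum_rec[of k m v] suminf_add[OF summable_G_val[OF assms] summable_H_sum[of "k + 1"]]
  by (simp add: eval_fps_def distrib_right)

lemma G_val_scaled_rec:
  assumes "k < m - 1"
  shows "fps_nth (G_val m v k) n * r ^ n = (if n = 1 then r else 0)
    + (\<Sum>i\<le>n. (fps_nth (H_sum m v (k + 1)) i * r ^ i) * (fps_nth (G_val m v k) (n - i) * r ^ (n - i)))"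
proof -
  have "fps_nth (G_val m v k) n * r ^ n
      = fps_nth (fps_X + H_sum m v (k + 1) * G_val m v k) n * r ^ n"
    using G_val_functional_eq[OF chain m assms] by metis
  also have "\<dots> = fps_nth fps_X n * r ^ n + fps_nth (H_sum m v (k + 1) * G_val m v k) n * r ^ n"
    by (simp only: fps_add_nth distrib_right)
  also have "fps_nth (fps_X :: real fps) n * r ^ n = (if n = 1 then r else 0)"
    by (simp add: fps_X_def)
  finally show ?thesis by (simp only: fps_mult_nth_scaled)
qed

text \<open>Both series converge absolutely at \<open>r\<close>, so the functional equation may be
  evaluated there; adding \<open>H_{k+1}(r)\<close> gives the recursion by
  \<open>Phi r\<close>.\<close>

lemma eval_G_val:
  assumes "k < m - 1"
  shows "eval_fps (G_val m v k) r = r / (1 - eval_fps (H_sum m v (k + 1)) r)"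
proof -
  let ?g = "\<lambda>n. fps_nth (G_val m v k) n * r ^ n"
  let ?h = "\<lambda>n. fps_nth (H_sum m v (k + 1)) n * r ^ n"
  have "summable (\<lambda>n. norm (?h n))" "summable (\<lambda>n. norm (?g n))"
    using summable_H_sum[of "k + 1"] summable_G_val[of k] assms r_pos
    by (simp_all add: abs_mult H_sum_nonneg G_val_nonneg)
  then have "(\<lambda>n. (if n = 1 then r else 0) + (\<Sum>i\<le>n. ?h i * ?g (n - i)))
      sums (r + suminf ?h * suminf ?g)"
    by (intro sums_add Cauchy_product_sums sums_single)
  then have "?g sums (r + suminf ?h * suminf ?g)"
    by (simp only: G_val_scaled_rec[OF assms, symmetric])
  then have "suminf ?g = r + suminf ?h * suminf ?g" by (rule sums_unique[symmetric])
  then have "suminf ?g * (1 - suminf ?h) = r" by (simp add: algebra_simps)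
  moreover have "1 - suminf ?h \<noteq> 0" using eval_H_sum_le[of "k + 1"] by (simp add: eval_fps_def)
  ultimately show ?thesis by (simp add: eval_fps_def eq_divide_eq)
qed

lemma q_ratio_scaled:
  "q_ratio m v k n = (fps_nth (H_sum m v k) n * r ^ n) / (fps_nth (G_all m v) n * r ^ n)"
  using r_pos by (simp add: q_ratio_def)

text \<open>\<open>ratio_limit_step\<close> with \<open>G_k\<close> as \<open>g\<close> and
  \<open>H_{k+1}\<close> as \<open>h\<close> passes convergence from \<open>k\<close> to
  \<open>k + 1\<close>. With \<open>w = r / (1 - u)\<close> the new limit is
  \<open>q * (1 - u) / (1 - u + w)\<close>, and the inverse factor \<open>1 + w / (1 - u)\<close> is
  the derivative of \<open>Phi r\<close> at \<open>u\<close>.\<close>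

lemma q_ratio_step:
  assumes k: "k < m - 1" and q: "q_ratio m v k \<longlonglongrightarrow> q"
  shows "\<exists>q'. q_ratio m v (k + 1) \<longlonglongrightarrow> q' \<and>
    q = (1 + r / (1 - eval_fps (H_sum m v (k + 1)) r)\<^sup>2) * q'"
proof -
  let ?a = "\<lambda>n. fps_nth (G_all m v) n * r ^ n"
  let ?g = "\<lambda>n. fps_nth (G_val m v k) n * r ^ n"
  let ?h = "\<lambda>n. fps_nth (H_sum m v (k + 1)) n * r ^ n"
  define u where "u = eval_fps (H_sum m v (k + 1)) r"
  define w where "w = r / (1 - u)"
  define e where "e = q * w / (1 - u + w)"
  have u: "u \<le> 1/2" unfolding u_def by (rule eval_H_sum_le)
  then have w: "0 < w" using r_pos by (simp add: w_def)
  have sums: "suminf ?h = u" "suminf ?g = w"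
    using eval_G_val[OF k] by (simp_all add: u_def w_def eval_fps_def)
  have hg: "?h n + ?g n = fps_nth (H_sum m v k) n * r ^ n" for n
    using H_sum_rec[of k m v] k by (simp add: distrib_right)
  have "(\<lambda>n. ?h n / ?a n) \<longlonglongrightarrow> q - q * suminf ?g / (1 - suminf ?h + suminf ?g)"
  proof (rule ratio_limit_step(2)[OF G_all_scaled])
    show "0 \<le> ?h n" "0 \<le> ?g n" for n using r_pos by (simp_all add: H_sum_nonneg G_val_nonneg)
    show "?h n + ?g n \<le> ?a n" for n
      unfolding hg using H_sum_le_G_all[of m v k n] m r_pos by (simp add: mult_right_mono)
    show "?g n = (\<Sum>i\<le>n. ?h i * ?g (n - i))" if "n \<ge> 2" for n
      using G_val_scaled_rec[OF k, of n] that by simp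
    show "(\<lambda>n. (?h n + ?g n) / ?a n) \<longlonglongrightarrow> q"
      using q unfolding hg q_ratio_scaled[symmetric] .
  qed
  then have "q_ratio m v (k + 1) \<longlonglongrightarrow> q - e"
    unfolding sums e_def q_ratio_scaled[symmetric] .
  moreover have "q = (1 + r / (1 - u)\<^sup>2) * (q - e)"
  proof -
    have "r / (1 - u)\<^sup>2 = w / (1 - u)" by (simp add: w_def power2_eq_square)
    moreover have "q - e = q * (1 - u) / (1 - u + w)"
      using u w by (simp add: e_def field_simps)
    moreover have "1 + w / (1 - u) = (1 - u + w) / (1 - u)"
      using u by (simp add: add_divide_distrib)
    moreover have "1 - u + w \<noteq> 0" "1 - u \<noteq> 0" using u w by auto
    ultimately show ?thesis by simp
  qed
  ultimately show ?thesis unfolding u_def by blast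
qed

text \<open>The induction starts from \<open>H_0 = G\<close>, whose ratio is 1 for all
  \<open>n \<ge> 1\<close>.\<close>

lemma q_ratio_convergent: "k \<le> m - 1 \<Longrightarrow> convergent (q_ratio m v k)"
proof (induction k)
  case 0
  have "eventually (\<lambda>n. q_ratio m v 0 n = 1) sequentially"
    by (rule eventually_sequentiallyI[of 1])
      (use G_all_scaled(2) m in \<open>force simp: q_ratio_scaled H_sum_0\<close>)
  then have "q_ratio m v 0 \<longlonglongrightarrow> 1" by (rule tendsto_eventually)
  then show ?case by (rule convergentI)
next
  case (Suc k)
  then obtain q where "q_ratio m v k \<longlonglongrightarrow> q" by (auto simp: convergent_def)
  with q_ratio_step[of k q] Suc.prems show ?case by (auto simp: convergent_def)
qed

lemma p_ratio_tendsto: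
  assumes k: "k < m - 1" and "q_ratio m v k \<longlonglongrightarrow> q" "q_ratio m v (k + 1) \<longlonglongrightarrow> q'"
  shows "p_ratio m v k \<longlonglongrightarrow> q - q'"
proof (rule Lim_transform_eventually[OF tendsto_diff[OF assms(2,3)]])
  show "eventually (\<lambda>n. q_ratio m v k n - q_ratio m v (k + 1) n = p_ratio m v k n) sequentially"
    by (rule eventually_sequentiallyI[of 1])
      (use H_sum_rec[of k m v] k in \<open>simp add: p_ratio_eq q_ratio_def add_divide_distrib\<close>)
qed

lemma p_ratio_top_tendsto:
  assumes "q_ratio m v (m - 1) \<longlonglongrightarrow> q"
  shows "p_ratio m v (m - 1) \<longlonglongrightarrow> q"
proof (rule Lim_transform_eventually[OF assms])
  show "eventually (\<lambda>n. q_ratio m v (m - 1) n = p_ratio m v (m - 1) n) sequentially"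
    by (rule eventually_sequentiallyI[of 1]) (simp add: p_ratio_eq q_ratio_def H_sum_def)
qed

end

theorem mainTheorem13:
  fixes m :: nat and v :: "nat \<Rightarrow> 'a::{linorder,zero,one}" and r :: real
  assumes "m \<ge> 2" and "godel_chain m v" and "r = 1 / (4 * real m)"
  shows
    "(\<forall>j<m. \<forall>x. \<bar>x\<bar> \<le> r \<longrightarrow> summable (\<lambda>n. fps_nth (G_val m v j) n * x ^ n)) \<and>
     (\<forall>x. \<bar>x\<bar> \<le> r \<longrightarrow> summable (\<lambda>n. fps_nth (G_all m v) n * x ^ n)) \<and>
     (\<forall>u. u \<noteq> 1 \<longrightarrow> (Phi r has_real_derivative 1 + r / (1 - u)\<^sup>2) (at u)) \<and>
     (\<exists>q p :: nat \<Rightarrow> real.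
        (\<forall>k\<le>m - 1. q_ratio m v k \<longlonglongrightarrow> q k) \<and>
        (\<forall>k\<le>m - 1. p_ratio m v k \<longlonglongrightarrow> p k) \<and>
        (\<forall>k\<le>m - 2. eval_fps (H_sum m v k) r = Phi r (eval_fps (H_sum m v (k + 1)) r)) \<and>
        q (m - 1) = p (m - 1) \<and>
        (\<forall>k\<le>m - 2. q k = deriv (Phi r) (eval_fps (H_sum m v (k + 1)) r) * q (k + 1)) \<and>
        (\<forall>k\<le>m - 2. p k = q k - q (k + 1)))"
proof -
  note ctx = assms(2,1,3)
  define q p where "q k = lim (q_ratio m v k)" and "p k = lim (p_ratio m v k)" for k
  have lt: "k < m - 1" if "k \<le> m - 2" for k using that assms(1) by linarith
  have q: "q_ratio m v k \<longlonglongrightarrow> q k" if "k \<le> m - 1" for k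
    using q_ratio_convergent[OF ctx that] by (simp add: q_def convergent_LIMSEQ_iff)
  have p_lt: "p_ratio m v k \<longlonglongrightarrow> q k - q (k + 1)" if "k < m - 1" for k
    using that by (intro p_ratio_tendsto[OF ctx] q) auto
  have p_top: "p_ratio m v (m - 1) \<longlonglongrightarrow> q (m - 1)"
    by (intro p_ratio_top_tendsto[OF ctx] q) simp
  have p_eq: "p k = q k - q (k + 1)" if "k < m - 1" for k
    unfolding p_def by (rule limI[OF p_lt[OF that]])
  have p_top_eq: "p (m - 1) = q (m - 1)" unfolding p_def by (rule limI[OF p_top])
  have p: "p_ratio m v k \<longlonglongrightarrow> p k" if "k \<le> m - 1" for k
  proof (cases "k = m - 1")
    case True
    then show ?thesis using p_top p_top_eq by simp
  next
    case False
    then show ?thesis using p_lt[of k] p_eq[of k] that by simp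
  qed
  have rec: "q k = deriv (Phi r) (eval_fps (H_sum m v (k + 1)) r) * q (k + 1)" if k: "k < m - 1" for k
  proof -
    let ?u = "eval_fps (H_sum m v (k + 1)) r"
    obtain q' where q': "q_ratio m v (k + 1) \<longlonglongrightarrow> q'" "q k = (1 + r / (1 - ?u)\<^sup>2) * q'"
      using q_ratio_step[OF ctx k q[of k]] k by auto
    \<comment> \<open>Uniqueness of limits identifies the limit supplied by
      \<open>q_ratio_step\<close> with the chosen \<open>q (k + 1)\<close>.\<close>
    have "q' = q (k + 1)" using LIMSEQ_unique[OF q'(1) q] k by simp
    moreover have "deriv (Phi r) ?u = 1 + r / (1 - ?u)\<^sup>2"
      using eval_H_sum_le[OF ctx, of "k + 1"] by (intro DERIV_imp_deriv Phi_has_derivative) auto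
    ultimately show ?thesis using q'(2) by simp
  qed
  have Phi_rec: "eval_fps (H_sum m v k) r = Phi r (eval_fps (H_sum m v (k + 1)) r)" if "k < m - 1" for k
    using eval_H_sum_rec[OF ctx, of k] eval_G_val[OF ctx that] that by (simp add: Phi_def)
  show ?thesis
  proof ((intro conjI allI impI);
      (rule exI[of _ q], rule exI[of _ p], intro conjI allI impI)?)
    show "summable (\<lambda>n. fps_nth (G_val m v j) n * x ^ n)" if "j < m" "\<bar>x\<bar> \<le> r" for j x
      using G_val_nonneg summable_G_val[OF ctx that(1)] that(2) by (rule summable_power_of_nonneg)
    show "summable (\<lambda>n. fps_nth (G_all m v) n * x ^ n)" if "\<bar>x\<bar> \<le> r" for x
    proof (rule summable_power_of_nonneg[OF _ G_all_scaled(4)[OF ctx] that])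
      show "0 \<le> fps_nth (G_all m v) n" for n by (simp add: G_all_def gen_fps_def)
    qed
  qed (blast intro: q p rec Phi_rec p_eq p_top_eq[symmetric] lt Phi_has_derivative)+
qed

end
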